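(* Let $R_1,\dots,R_n\subseteq\mathbb{R}^n$ be nonempty convex sets and let $R=\prod_{i=1}^nR_i$ be the set of $n\times n$ matrices whose $i$-th row lies in $R_i$ for every $i$. Suppose there exists $c>0$ such that $|\det M|=c$ for all $M\in R$. Then, after suitably reordering the $R_i$'s, there are affine subspaces $S_1,\dots,S_n$ of $\mathbb{R}^n$ with $R_i\subseteq S_i$, $\dim S_i=i-1$, $0\notin S_i$, and, for each $i\ge2$, $S_i$ is a translation of the linear hull of $S_{i-1}$. *)

theory Defs
  imports "HOL-Analysis.Analysis"
begin

definition row_prod :: "('n::finite \<Rightarrow> (real ^ 'n) set) \<Rightarrow> (real ^ 'n ^ 'n) set" where
  "row_prod R = {M. \<forall>i. row i M \<in> R i}"

end

theory Submission
  imports Defs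
begin

text \<open>
  Pick \<open>a i \<in> R i\<close>; these vectors form a basis. By convexity \<open>det\<close> itself is constant, so by
  multilinearity it vanishes as soon as the rows in some nonempty index set are replaced by
  differences of elements of the corresponding \<open>R i\<close>. Draw an edge \<open>i \<rightarrow> j\<close> if some \<open>x - a i\<close> with
  \<open>x \<in> R i\<close> has a nonzero \<open>j\<close>-th coordinate in the basis \<open>a\<close>. If the graph had a cycle, then on a
  minimal nonempty vertex set in which every vertex has a successor the edges would form
  the graph of a permutation, and replacing the rows of \<open>a\<close> in that set by suitable differences would
  give another basis, a contradiction. A topological sorting of the graph is the required ordering.
\<close>

section \<open>Determinants and row differences\<close>

lemma det_fun_upd_add:
  fixes f :: "'n::finite \<Rightarrow> 'a::comm_ring_1 ^ 'n"
  shows "det (\<chi> i. (f(k := u + v)) i) = det (\<chi> i. (f(k := u)) i) + det (\<chi> i. (f(k := v)) i)"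
  using det_row_add[of k "\<lambda>_. u" "\<lambda>_. v" f] by (simp add: fun_upd_def)

lemma det_fun_upd_diff:
  fixes f :: "'n::finite \<Rightarrow> 'a::comm_ring_1 ^ 'n"
  shows "det (\<chi> i. (f(k := u - v)) i) = det (\<chi> i. (f(k := u)) i) - det (\<chi> i. (f(k := v)) i)"
  using det_fun_upd_add[of f k "u - v" v] by simp

lemma det_fun_upd_scaleR:
  fixes f :: "'n::finite \<Rightarrow> real ^ 'n"
  shows "det (\<chi> i. (f(k := c *\<^sub>R u)) i) = c * det (\<chi> i. (f(k := u)) i)"
  using det_row_mul[of k c "\<lambda>_. u" f] unfolding scalar_mult_eq_scaleR by (simp add: fun_upd_def)

lemma det_rows_nonzero_iff_span:
  fixes f :: "'n::finite \<Rightarrow> real ^ 'n"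
  shows "det (\<chi> i. f i) \<noteq> 0 \<longleftrightarrow> span (range f) = UNIV"
proof -
  have "rows (\<chi> i. f i) = range f"
    by (auto simp: rows_def row_def)
  then show ?thesis
    using matrix_left_invertible_span_rows[of "\<chi> i. f i"]
      invertible_det_nz[of "\<chi> i. f i"] invertible_left_inverse[of "\<chi> i. f i"]
    by simp
qed

lemma
  fixes f :: "'n::finite \<Rightarrow> real ^ 'n"
  assumes "det (\<chi> i. f i) \<noteq> 0"
  shows det_rows_nonzero_inj: "inj f"
    and det_rows_nonzero_independent: "independent (range f)"
proof -
  have span: "span (range f) = UNIV"
    using assms det_rows_nonzero_iff_span by blast
  have "CARD('n) \<le> card (range f)"
    using dim_le_card[of "UNIV :: (real ^ 'n) set" "range f"] span by simp
  moreover have le: "card (range f) \<le> CARD('n)"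
    by (rule card_image_le) simp
  ultimately show "inj f"
    by (intro eq_card_imp_inj_on) auto
  show "independent (range f)"
    using le span by (intro card_le_dim_spanning[of _ UNIV]) auto
qed

text \<open>With the other rows fixed, the determinant is linear in row \<open>k\<close>. If its
  values at \<open>x\<close> and \<open>y\<close> differed, they would be \<open>c\<close> and
  \<open>-c\<close>, and the midpoint, which lies in \<open>R k\<close> by convexity, would give
  determinant 0.\<close>

lemma det_rows_unchanged:
  fixes R :: "'n::finite \<Rightarrow> (real ^ 'n) set"
  assumes "convex (R k)" "c > 0"
    and det: "\<And>g. (\<And>i. g i \<in> R i) \<Longrightarrow> \<bar>det (\<chi> i. g i)\<bar> = c"
    and f: "\<And>i. i \<noteq> k \<Longrightarrow> f i \<in> R i"
    and xy: "x \<in> R k" "y \<in> R k"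
  shows "det (\<chi> i. (f(k := x)) i) = det (\<chi> i. (f(k := y)) i)"
proof (rule ccontr)
  let ?d = "\<lambda>z. det (\<chi> i. (f(k := z)) i)"
  have abs: "\<bar>?d z\<bar> = c" if "z \<in> R k" for z
    using f that by (intro det) auto
  assume "?d x \<noteq> ?d y"
  then have "?d x = - ?d y"
    using abs[OF xy(1)] abs[OF xy(2)] by linarith
  then have "?d ((1/2) *\<^sub>R x + (1/2) *\<^sub>R y) = 0"
    by (simp only: det_fun_upd_add det_fun_upd_scaleR)
  moreover have "(1/2) *\<^sub>R x + (1/2) *\<^sub>R y \<in> R k"
    using assms(1) xy by (intro convexD) auto
  ultimately show False
    using abs[of "(1/2) *\<^sub>R x + (1/2) *\<^sub>R y"] \<open>c > 0\<close> by simp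
qed

text \<open>Induction on \<open>T\<close>: linearity in row \<open>k\<close> splits the determinant
  into the difference of those with rows \<open>x\<close> and \<open>y\<close>. If \<open>T\<close>
  is \<open>{k}\<close>, these agree by \<open>det_rows_unchanged\<close>; otherwise both vanish by
  the induction hypothesis.\<close>

lemma det_row_differences_eq_0:
  fixes R :: "'n::finite \<Rightarrow> (real ^ 'n) set"
  assumes "\<And>i. convex (R i)" "c > 0"
    and det: "\<And>g. (\<And>i. g i \<in> R i) \<Longrightarrow> \<bar>det (\<chi> i. g i)\<bar> = c"
    and "T \<noteq> {}"
    and "\<And>i. i \<in> T \<Longrightarrow> \<exists>x\<in>R i. \<exists>y\<in>R i. f i = x - y"
    and "\<And>i. i \<notin> T \<Longrightarrow> f i \<in> R i"
  shows "det (\<chi> i. f i) = 0"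
  using finite[of T] assms(4-)
proof (induction T arbitrary: f rule: finite_ne_induct)
  case (singleton k)
  then obtain x y where xy: "x \<in> R k" "y \<in> R k" "f k = x - y"
    by blast
  then have "f = f(k := x - y)"
    by auto
  moreover have "det (\<chi> i. (f(k := x)) i) = det (\<chi> i. (f(k := y)) i)"
    using assms(1,2) det singleton xy by (intro det_rows_unchanged[of R]) auto
  ultimately show ?case
    by (metis det_fun_upd_diff diff_self)
next
  case (insert k T)
  then obtain x y where xy: "x \<in> R k" "y \<in> R k" "f k = x - y"
    by blast
  then have "f = f(k := x - y)"
    by auto
  moreover have "det (\<chi> i. (f(k := z)) i) = 0" if "z \<in> R k" for z
    using insert.prems insert.hyps that by (intro insert.IH) auto
  ultimately show ?case
    using xy by (metis det_fun_upd_diff diff_self)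
qed

section \<open>Acyclic relations on finite sets\<close>

text \<open>Take for \<open>L\<close> a set of least cardinality among the nonempty subsets of
  \<open>K\<close> in which every element has a successor. Minimality forces every choice of
  successors within \<open>L\<close> to be a permutation, which leaves room for only one
  choice.\<close>

lemma permutation_of_successors:
  assumes "finite K" "K \<noteq> {}" "\<And>i. i \<in> K \<Longrightarrow> \<exists>j\<in>K. E i j"
  obtains L f where "L \<subseteq> K" "L \<noteq> {}" "bij_betw f L L"
    "\<And>i j. i \<in> L \<Longrightarrow> j \<in> L \<Longrightarrow> E i j \<longleftrightarrow> j = f i"
proof -
  define P where "P = (\<lambda>L. L \<subseteq> K \<and> L \<noteq> {} \<and> (\<forall>i\<in>L. \<exists>j\<in>L. E i j))"
  have "P K"
    using assms by (auto simp: P_def)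
  then obtain L where L: "P L" and least: "\<And>L'. P L' \<Longrightarrow> card L \<le> card L'"
    by (metis arg_min_nat_lemma)
  then have fin: "finite L"
    using assms(1) by (auto simp: P_def intro: finite_subset)
  have bij: "bij_betw g L L" if g: "\<And>i. i \<in> L \<Longrightarrow> g i \<in> L \<and> E i (g i)" for g
  proof -
    \<comment> \<open>An element \<open>g x\<close> of the image has the successor
      \<open>g (g x)\<close>, again in the image.\<close>
    have "P (g ` L)"
      using L g unfolding P_def by blast
    then have "g ` L = L"
      using g least by (intro card_seteq[OF fin]) auto
    then show ?thesis
      by (simp add: bij_betw_def eq_card_imp_inj_on[OF fin])
  qed
  obtain f where f: "\<And>i. i \<in> L \<Longrightarrow> f i \<in> L \<and> E i (f i)"
    using L unfolding P_def by metis
  have "j = f i" if ij: "i \<in> L" "j \<in> L" "E i j" for i j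
  proof (rule ccontr)
    assume neq: "j \<noteq> f i"
    obtain m where m: "m \<in> L" "f m = j"
      using bij[OF f] ij(2) by (metis bij_betw_def imageE)
    \<comment> \<open>Redirecting \<open>i\<close> to \<open>j\<close> is another choice of
      successors, hence injective on \<open>L\<close>; yet it sends both \<open>m\<close> and
      \<open>i\<close> to \<open>j\<close>.\<close>
    have "bij_betw (f(i := j)) L L"
      using f ij by (intro bij) auto
    moreover have "m \<noteq> i" "(f(i := j)) m = (f(i := j)) i"
      using m neq by auto
    ultimately show False
      using m(1) ij(1) by (meson bij_betw_def inj_onD)
  qed
  then show thesis
    using that[of L f] L f bij[OF f] unfolding P_def by blast
qed

text \<open>A sink of \<open>U\<close> goes to the front and the rest is sorted recursively, so
  edges between different entries only lead from later to earlier ones.\<close>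

lemma topological_sorting:
  assumes "finite U" "\<And>K. K \<subseteq> U \<Longrightarrow> K \<noteq> {} \<Longrightarrow> \<exists>i\<in>K. \<forall>j\<in>K. \<not> E i j"
  obtains xs where "distinct xs" "set xs = U" "sorted_wrt (\<lambda>x y. \<not> E x y) xs"
  using assms
proof (induction U arbitrary: thesis rule: finite_psubset_induct)
  case (psubset U)
  show ?case
  proof (cases "U = {}")
    case True
    then show ?thesis
      using psubset.prems(1)[of "[]"] by simp
  next
    case False
    then obtain s where s: "s \<in> U" "\<forall>j\<in>U. \<not> E s j"
      using psubset.prems(2)[of U] by blast
    have "U - {s} \<subset> U"
      using s(1) by blast
    then obtain xs where "distinct xs" "set xs = U - {s}" "sorted_wrt (\<lambda>x y. \<not> E x y) xs"
      using psubset.IH[of "U - {s}"] psubset.prems(2) by (metis psubset_imp_subset subset_trans)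
    then show ?thesis
      using psubset.prems(1)[of "s # xs"] s by auto
  qed
qed

section \<open>The flag of affine subspaces\<close>

text \<open>This links consecutive members of the flag: passing to the linear hull adds the
  translation vector \<open>t\<close> to the spanning set. Each \<open>b\<close> is recovered as
  \<open>(t + b) - t\<close>.\<close>

lemma span_translated_span: "span ((+) t ` span B) = span (insert t B)"
  for t :: "'a::real_vector"
proof
  show "span ((+) t ` span B) \<subseteq> span (insert t B)"
  proof (intro span_minimal subspace_span)
    show "(+) t ` span B \<subseteq> span (insert t B)"
      using span_mono[OF subset_insertI[of B t]]
      by (auto intro!: span_add span_base[of t])
  qed
  have t: "t \<in> span ((+) t ` span B)"
    using image_eqI[of t "(+) t" 0 "span B"] span_zero[of B] by (simp add: span_base)
  have "b \<in> span ((+) t ` span B)" if "b \<in> B" for b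
  proof -
    have "t + b \<in> span ((+) t ` span B)"
      using that by (auto intro!: span_base)
    then show ?thesis
      using t span_add_eq by blast
  qed
  then show "span (insert t B) \<subseteq> span ((+) t ` span B)"
    using t by (intro span_minimal subspace_span) auto
qed

lemma zero_in_translated_span_iff: "0 \<in> (+) t ` span B \<longleftrightarrow> t \<in> span B"
  for t :: "'a::real_vector"
proof -
  have "0 \<in> (+) t ` span B \<longleftrightarrow> - t \<in> span B"
    by (auto simp: image_iff eq_neg_iff_add_eq_0 add.commute dest: minus_unique intro: bexI[of _ "- t"])
  then show ?thesis
    using span_neg by force
qed

lemma sum_coordinates:
  fixes a :: "'n::finite \<Rightarrow> real ^ 'n"
  assumes "det (\<chi> i. a i) \<noteq> 0"
  shows "(\<Sum>j\<in>UNIV. representation (range a) v (a j) *\<^sub>R a j) = v"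
proof -
  have "(\<Sum>b\<in>range a. representation (range a) v b *\<^sub>R b) = v"
    using det_rows_nonzero_independent[OF assms] det_rows_nonzero_iff_span[of a] assms
    by (intro sum_representation_eq) auto
  then show ?thesis
    using sum.reindex[OF det_rows_nonzero_inj[OF assms], of "\<lambda>b. representation (range a) v b *\<^sub>R b"]
    by simp
qed

text \<open>This is the acyclicity of the graph. Without a sink in \<open>K\<close> there is a set
  \<open>L\<close> permuted by its edges; the rows of \<open>g\<close> are differences on
  \<open>L\<close>, so their determinant is 0, but they still span the whole space.\<close>

lemma exists_sink:
  fixes R :: "'n::finite \<Rightarrow> (real ^ 'n) set"
  assumes "\<And>i. convex (R i)" "c > 0"
    and det: "\<And>g. (\<And>i. g i \<in> R i) \<Longrightarrow> \<bar>det (\<chi> i. g i)\<bar> = c"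
    and a: "\<And>i. a i \<in> R i"
    and "K \<noteq> {}"
  shows "\<exists>i\<in>K. \<forall>j\<in>K. \<forall>x\<in>R i. representation (range a) (x - a i) (a j) = 0"
proof (rule ccontr)
  define r where "r = (\<lambda>i j x. representation (range a) (x - a i) (a j))"
  define E where "E = (\<lambda>i j. \<exists>x\<in>R i. r i j x \<noteq> 0)"
  have a_nz: "det (\<chi> i. a i) \<noteq> 0"
    using det[of a] a \<open>c > 0\<close> by auto
  assume "\<not> ?thesis"
  then have succ: "\<exists>j\<in>K. E i j" if "i \<in> K" for i
    using that unfolding E_def r_def by blast
  obtain L f where "L \<subseteq> K" and L: "L \<noteq> {}" and bij: "bij_betw f L L"
    and f: "\<And>i j. i \<in> L \<Longrightarrow> j \<in> L \<Longrightarrow> E i j \<longleftrightarrow> j = f i"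
    using permutation_of_successors[of K E, OF finite \<open>K \<noteq> {}\<close> succ] by blast
  have fL: "f i \<in> L" if "i \<in> L" for i
    using bij that by (auto simp: bij_betw_def)
  have "\<forall>i\<in>L. \<exists>x\<in>R i. r i (f i) x \<noteq> 0"
    using f fL unfolding E_def by blast
  then obtain x where x: "\<And>i. i \<in> L \<Longrightarrow> x i \<in> R i" "\<And>i. i \<in> L \<Longrightarrow> r i (f i) (x i) \<noteq> 0"
    by metis
  define g where "g = (\<lambda>i. if i \<in> L then x i - a i else a i)"
  have "det (\<chi> i. g i) = 0"
  proof (rule det_row_differences_eq_0[OF assms(1,2) det L])
    show "\<exists>y\<in>R i. \<exists>z\<in>R i. g i = y - z" if "i \<in> L" for i
      using that x(1) a unfolding g_def by auto
  qed (use a in \<open>auto simp: g_def\<close>)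
  moreover have "range a \<subseteq> span (range g)"
  proof -
    have outside: "a j \<in> span (range g)" if "j \<notin> L" for j
      using that by (intro span_base) (auto simp: g_def intro!: image_eqI[of _ _ j])
    have "a (f i) \<in> span (range g)" if i: "i \<in> L" for i
    proof -
      \<comment> \<open>Within \<open>L\<close> the only edge from \<open>i\<close> goes to
        \<open>f i\<close>. All other nonzero coordinates of \<open>g i\<close> thus belong to
        vectors \<open>a j\<close> with \<open>j\<close> outside \<open>L\<close>, which are rows of
        \<open>g\<close> themselves, and \<open>a (f i)\<close> can be solved for.\<close>
      have zero: "r i j (x i) = 0" if "j \<in> L" "j \<noteq> f i" for j
        using f[OF i that(1)] that(2) x(1)[OF i] unfolding E_def by blast
      have "g i = (\<Sum>j\<in>UNIV. r i j (x i) *\<^sub>R a j)"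
        using i sum_coordinates[OF a_nz] by (simp add: g_def r_def)
      also have "\<dots> = r i (f i) (x i) *\<^sub>R a (f i) + (\<Sum>j\<in>UNIV - {f i}. r i j (x i) *\<^sub>R a j)"
        by (rule sum.remove) auto
      finally have "r i (f i) (x i) *\<^sub>R a (f i) = g i - (\<Sum>j\<in>UNIV - {f i}. r i j (x i) *\<^sub>R a j)"
        by simp
      moreover have "(\<Sum>j\<in>UNIV - {f i}. r i j (x i) *\<^sub>R a j) \<in> span (range g)"
      proof (rule span_sum)
        fix j assume "j \<in> UNIV - {f i}"
        then show "r i j (x i) *\<^sub>R a j \<in> span (range g)"
          using zero[of j] outside[of j] by (cases "j \<in> L") (auto intro: span_scale span_zero)
      qed
      ultimately have "r i (f i) (x i) *\<^sub>R a (f i) \<in> span (range g)"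
        by (auto intro: span_diff span_base)
      then have "inverse (r i (f i) (x i)) *\<^sub>R (r i (f i) (x i) *\<^sub>R a (f i)) \<in> span (range g)"
        by (rule span_scale)
      then show ?thesis
        using x(2)[OF i] by simp
    qed
    moreover have "f ` L = L"
      using bij by (simp add: bij_betw_def)
    ultimately have "a j \<in> span (range g)" if "j \<in> L" for j
      using that by (metis imageE)
    then show ?thesis
      using outside by blast
  qed
  then have "span (range g) = UNIV"
    using span_minimal[of "range a" "span (range g)"] det_rows_nonzero_iff_span[of a] a_nz
    by auto
  ultimately show False
    using det_rows_nonzero_iff_span[of g] by simp
qed

theorem theorem23:
  fixes R :: "'n::finite \<Rightarrow> (real ^ 'n) set" and c :: real
  assumes "\<And>i. R i \<noteq> {}"
    and "\<And>i. convex (R i)"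
    and "c > 0"
    and "\<And>M. M \<in> row_prod R \<Longrightarrow> \<bar>det M\<bar> = c"
  shows "\<exists>(p :: nat \<Rightarrow> 'n) (S :: nat \<Rightarrow> (real ^ 'n) set).
    bij_betw p {1..CARD('n)} UNIV \<and>
    (\<forall>i\<in>{1..CARD('n)}.
       affine (S i) \<and> R (p i) \<subseteq> S i \<and> aff_dim (S i) = int i - 1 \<and> 0 \<notin> S i) \<and>
    (\<forall>i\<in>{2..CARD('n)}. \<exists>t. S i = (+) t ` span (S (i - 1)))"
proof -
  have det: "\<bar>det (\<chi> i. g i)\<bar> = c" if "\<And>i. g i \<in> R i" for g
    using that by (intro assms(4)) (simp add: row_prod_def row_def)
  have "\<forall>i. \<exists>x. x \<in> R i"
    using assms(1) by blast
  then obtain a where a: "\<And>i. a i \<in> R i"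
    by metis
  have a_nz: "det (\<chi> i. a i) \<noteq> 0"
    using det[of a] a \<open>c > 0\<close> by auto
  note inj = det_rows_nonzero_inj[OF a_nz] and indep = det_rows_nonzero_independent[OF a_nz]
  define E where "E = (\<lambda>i j. \<exists>x\<in>R i. representation (range a) (x - a i) (a j) \<noteq> 0)"
  have sink: "\<exists>i\<in>K. \<forall>j\<in>K. \<not> E i j" if "K \<noteq> {}" for K
    using exists_sink[of R c a K] assms(2) \<open>c > 0\<close> det a that unfolding E_def by blast
  \<comment> \<open>Loops are excluded separately, since \<open>sorted_wrt\<close> compares only
    different positions.\<close>
  then have irrefl: "\<not> E i i" for i
    using sink[of "{i}"] by simp
  obtain xs where xs: "distinct xs" "set xs = UNIV" "sorted_wrt (\<lambda>x y. \<not> E x y) xs"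
    using topological_sorting[of UNIV E] sink by auto
  have len: "length xs = CARD('n)"
    using xs(1,2) distinct_card by metis
  \<comment> \<open>The shift turns list positions counted from 0 into indices counted from
    1.\<close>
  define p where "p = (\<lambda>i. xs ! (i - 1))"
  have "bij_betw (\<lambda>i. i - 1) {1..CARD('n)} {..<CARD('n)}"
    by (rule bij_betw_byWitness[of _ Suc]) auto
  then have bij: "bij_betw p {1..CARD('n)} UNIV"
    using bij_betw_trans[OF _ bij_betw_nth[OF xs(1) refl xs(2)[symmetric]]] len
    by (simp add: p_def comp_def)
  have not_E: "\<not> E (p i) (p k)" if "1 \<le> i" "i \<le> k" "k \<le> CARD('n)" for i k
  proof (cases "i = k")
    case False
    then show ?thesis
      using sorted_wrt_nth_less[OF xs(3), of "i - 1" "k - 1"] that len by (simp add: p_def)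
  qed (use irrefl in simp)
  \<comment> \<open>\<open>B i\<close> consists of the \<open>i - 1\<close> basis vectors preceding
    \<open>a (p i)\<close> in the new order; in particular \<open>B 1\<close> is empty and
    \<open>S 1\<close> is the single point \<open>a (p 1)\<close>.\<close>
  define B where "B = (\<lambda>i. a ` p ` {1..<i})"
  define S where "S = (\<lambda>i. (+) (a (p i)) ` span (B i))"
  have "affine (S i)" for i
    unfolding S_def by (simp add: affine_translation[symmetric] subspace_imp_affine)
  moreover have "R (p i) \<subseteq> S i" if i: "i \<in> {1..CARD('n)}" for i
  proof
    fix x assume x: "x \<in> R (p i)"
    \<comment> \<open>By \<open>not_E\<close>, only the coordinates at \<open>p k\<close> with
      \<open>k < i\<close> can be nonzero.\<close>
    have "(\<Sum>j\<in>UNIV. representation (range a) (x - a (p i)) (a j) *\<^sub>R a j) \<in> span (B i)"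
    proof (rule span_sum)
      fix j
      obtain k where k: "k \<in> {1..CARD('n)}" "j = p k"
        using bij by (metis UNIV_I bij_betw_def imageE)
      show "representation (range a) (x - a (p i)) (a j) *\<^sub>R a j \<in> span (B i)"
      proof (cases "k < i")
        case True
        then have "a j \<in> B i"
          using k by (simp add: B_def)
        then show ?thesis
          by (intro span_scale span_base)
      next
        case False
        then have "representation (range a) (x - a (p i)) (a j) = 0"
          using not_E[of i k] i k x unfolding E_def by auto
        then show ?thesis
          by (simp add: span_zero)
      qed
    qed
    then have "x - a (p i) \<in> span (B i)"
      by (simp add: sum_coordinates[OF a_nz])
    then show "x \<in> S i"
      unfolding S_def by (intro image_eqI[of _ _ "x - a (p i)"]) auto
  qed
  moreover have "aff_dim (S i) = int i - 1" if i: "i \<in> {1..CARD('n)}" for i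
  proof -
    have "independent (B i)"
      using indep by (rule independent_mono) (auto simp: B_def)
    moreover have "inj_on p {1..<i}"
      using bij i by (auto simp: bij_betw_def intro: inj_on_subset)
    then have "card (B i) = i - 1"
      using inj by (simp add: B_def card_image inj_on_subset)
    ultimately show ?thesis
      using i by (simp add: S_def aff_dim_translation_eq aff_dim_subspace dim_eq_card_independent)
  qed
  moreover have "0 \<notin> S i" if i: "i \<in> {1..CARD('n)}" for i
  proof -
    \<comment> \<open>If 0 were in \<open>S i\<close>, then \<open>a (p i)\<close> would lie in the
      span of other basis vectors.\<close>
    have "p i \<notin> p ` {1..<i}"
      using inj_on_image_mem_iff[of p "{1..CARD('n)}" i "{1..<i}"] bij i
      by (simp add: bij_betw_def subset_iff)
    then have "a (p i) \<notin> B i"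
      by (simp add: B_def inj_image_mem_iff[OF inj])
    then have "B i \<subseteq> range a - {a (p i)}"
      unfolding B_def by blast
    moreover have "a (p i) \<notin> span (range a - {a (p i)})"
      using indep by (auto simp: dependent_def)
    ultimately show ?thesis
      unfolding S_def zero_in_translated_span_iff using span_mono by blast
  qed
  moreover have "\<exists>t. S i = (+) t ` span (S (i - 1))" if i: "i \<in> {2..CARD('n)}" for i
  proof -
    \<comment> \<open>As \<open>i\<close> is at least 2, \<open>B i\<close> is
      \<open>B (i - 1)\<close> with \<open>a (p (i - 1))\<close> added, so its span is the linear
      hull of \<open>S (i - 1)\<close>.\<close>
    have "{1..<i} = insert (i - 1) {1..<i - 1}"
      using i by auto
    then have "B i = insert (a (p (i - 1))) (B (i - 1))"
      by (simp add: B_def)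
    then have "S i = (+) (a (p i)) ` span (S (i - 1))"
      by (simp add: S_def span_translated_span)
    then show ?thesis ..
  qed
  ultimately show ?thesis
    using bij by (intro exI[of _ p] exI[of _ S] conjI ballI)
qed

end
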